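(* Let $I\subset\mathbb{R}$ be an open interval, let $P_0$ be a constant, and let $\rho_e:I\to\mathbb{R}$ be an arbitrary smooth function (equilibrium density distribution). Define on $I$ $$u_e(x)=0,\qquad P_e(x)=P_0-\kappa\int\rho_e(x)\,dx,\qquad P_{2e}(x)=P_e(x),\qquad R_e(x)^3=\frac1{\rho_e(x)}+X-1,$$ where $\int\rho_e\,dx$ is a fixed antiderivative of $\rho_e$, and assume the data are admissible, i.e. $\rho_e>0$, $R_e>0$ and $P_e>0$ on $I$. Then the time-independent fields $\rho=\rho_e(x)$, $u=0$, $R=R_e(x)$, $P=P_e(x)$, $P_2=P_{2e}(x)$ solve the dimensionless bubbly fluid system given in the context, with initial reference data $\hat P=P_{2e}$ and $\hat R=R_e$.
   Context: The dimensionless one-dimensional bubbly fluid system, for unknown fields $\rho,u,P,P_2,R$ depending on $(x,t)$, is $$\rho_t+(\rho u)_x=0,$$ $$(\rho u)_t+(\rho u^2+P)_x-u_{xx}+\kappa\rho=0,$$ $$P=P_2-\left(R\,\mathcal{D}_t^2R+\tfrac32(\mathcal{D}_tR)^2+\tfrac43\frac{\mathcal{D}_tR}{R}\right),$$ $$\mathcal{D}_tP_2+3\gamma P_2\frac{\mathcal{D}_tR}{R}+3(\gamma-1)\frac{T_0}{R}\left(\frac{P_2}{\hat P}\frac{R^3}{\hat R^3}-1\right)=0,$$ $$(1-X+R^3)\rho-1=0,$$ where $\mathcal{D}_t=\partial_t+u\,\partial_x$, and $\kappa\ge 0$, $\gamma>1$, $0<X<1$, $T_0$ are constants. The reference data $\hat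 P(x)$, $\hat R(x)$ are the initial gas pressure and the initial bubble radius, $\hat P=P_2|_{t=0}$, $\hat R=R|_{t=0}$. *)

theory Defs
  imports "HOL-Analysis.Analysis"
begin

text \<open>Infinite differentiability of a function of one variable; meant for open \<open>S\<close>, where
  \<open>deriv\<close> only sees the values of the function on \<open>S\<close>.\<close>

definition smooth_on :: "real set \<Rightarrow> (real \<Rightarrow> real) \<Rightarrow> bool" where
  "smooth_on S f \<longleftrightarrow> (\<forall>n. \<forall>x\<in>S. ((deriv ^^ n) f) differentiable (at x))"

text \<open>A field \<open>f :: real \<Rightarrow> real \<Rightarrow> real\<close> takes the position \<open>x\<close> first and the time \<open>t\<close> second.
  Positions range over an open interval \<open>I\<close>, times over an interval \<open>J\<close> that need not be open:
  the time derivative is taken within \<open>J\<close>, so it is one-sided at an end point of \<open>J\<close>, for example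
  at \<open>t = 0\<close> if \<open>J = {0..}\<close>.\<close>

definition dx :: "(real \<Rightarrow> real \<Rightarrow> real) \<Rightarrow> real \<Rightarrow> real \<Rightarrow> real" where
  "dx f x t = deriv (\<lambda>y. f y t) x"

definition dt :: "real set \<Rightarrow> (real \<Rightarrow> real \<Rightarrow> real) \<Rightarrow> real \<Rightarrow> real \<Rightarrow> real" where
  "dt J f x t = vector_derivative (\<lambda>s. f x s) (at t within J)"

definition material_deriv ::
    "real set \<Rightarrow> (real \<Rightarrow> real \<Rightarrow> real) \<Rightarrow> (real \<Rightarrow> real \<Rightarrow> real) \<Rightarrow> real \<Rightarrow> real \<Rightarrow> real" where
  "material_deriv J u f x t = dt J f x t + u x t * dx f x t"

definition C1_field :: "real set \<Rightarrow> real set \<Rightarrow> (real \<Rightarrow> real \<Rightarrow> real) \<Rightarrow> bool" where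
  "C1_field I J f \<longleftrightarrow>
     (\<forall>x\<in>I. \<forall>t\<in>J. (\<lambda>y. f y t) differentiable (at x)
                  \<and> (\<lambda>s. f x s) differentiable (at t within J)) \<and>
     continuous_on (I \<times> J) (\<lambda>(x, t). dx f x t) \<and>
     continuous_on (I \<times> J) (\<lambda>(x, t). dt J f x t)"

definition C2_field :: "real set \<Rightarrow> real set \<Rightarrow> (real \<Rightarrow> real \<Rightarrow> real) \<Rightarrow> bool" where
  "C2_field I J f \<longleftrightarrow> C1_field I J f \<and> C1_field I J (dx f) \<and> C1_field I J (dt J f)"

text \<open>Classical solutions of the dimensionless bubbly fluid system on \<open>I \<times> J\<close> (with \<open>0 \<in> J\<close>).
  Since \<open>deriv\<close>, \<open>vector_derivative\<close> and division are total, the existence of every derivative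
  in the equations and the non-vanishing of every denominator are part of the definition:
  \<open>u\<close> and \<open>R\<close>, which are differentiated twice, are \<open>C\<^sup>2\<close>, the other fields are \<open>C\<^sup>1\<close>.\<close>

definition bubbly_fluid_solution ::
    "real \<Rightarrow> real \<Rightarrow> real \<Rightarrow> real \<Rightarrow> real set \<Rightarrow> real set \<Rightarrow> (real \<Rightarrow> real) \<Rightarrow> (real \<Rightarrow> real) \<Rightarrow>
     (real \<Rightarrow> real \<Rightarrow> real) \<Rightarrow> (real \<Rightarrow> real \<Rightarrow> real) \<Rightarrow> (real \<Rightarrow> real \<Rightarrow> real) \<Rightarrow>
     (real \<Rightarrow> real \<Rightarrow> real) \<Rightarrow> (real \<Rightarrow> real \<Rightarrow> real) \<Rightarrow> bool" where
  "bubbly_fluid_solution \<kappa> \<gamma> X T\<^sub>0 I J Phat Rhat \<rho> u P P\<^sub>2 R \<longleftrightarrow>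
     C1_field I J \<rho> \<and> C2_field I J u \<and> C1_field I J P \<and> C1_field I J P\<^sub>2 \<and> C2_field I J R \<and>
     (\<forall>x\<in>I. Phat x = P\<^sub>2 x 0 \<and> Rhat x = R x 0 \<and> Phat x \<noteq> 0 \<and> Rhat x \<noteq> 0) \<and>
     (\<forall>x\<in>I. \<forall>t\<in>J.
        R x t \<noteq> 0 \<and>
        dt J \<rho> x t + dx (\<lambda>x t. \<rho> x t * u x t) x t = 0 \<and>
        dt J (\<lambda>x t. \<rho> x t * u x t) x t + dx (\<lambda>x t. \<rho> x t * (u x t)\<^sup>2 + P x t) x t
          - dx (dx u) x t + \<kappa> * \<rho> x t = 0 \<and>
        P x t = P\<^sub>2 x t
          - (R x t * material_deriv J u (material_deriv J u R) x t
             + 3 / 2 * (material_deriv J u R x t)\<^sup>2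
             + 4 / 3 * (material_deriv J u R x t / R x t)) \<and>
        material_deriv J u P\<^sub>2 x t
          + 3 * \<gamma> * P\<^sub>2 x t * (material_deriv J u R x t / R x t)
          + 3 * (\<gamma> - 1) * (T\<^sub>0 / R x t)
              * (P\<^sub>2 x t / Phat x * ((R x t) ^ 3 / (Rhat x) ^ 3) - 1) = 0 \<and>
        (1 - X + (R x t) ^ 3) * \<rho> x t - 1 = 0)"

end

theory Submission
  imports Defs
begin

text \<open>With \<open>u = 0\<close> and time-independent fields every material derivative vanishes, so the system
  reduces to the hydrostatic balance \<open>P' + \<kappa> \<rho> = 0\<close>, the identities \<open>P = P\<^sub>2\<close>,
  \<open>P\<^sub>2 R\<^sup>3 = Phat Rhat\<^sup>3\<close> and the algebraic relation between \<open>\<rho>\<close> and \<open>R\<close>, which all hold by the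
  choice of the fields. What is left is regularity: \<open>R\<close> is \<open>C\<^sup>2\<close> because it is the cube root of a
  positive smooth function.\<close>

text \<open>If \<open>at t within J\<close> were \<open>bot\<close>, every vector would be a
  derivative at \<open>t\<close> and \<open>vector_derivative\<close> would be an arbitrary choice.
  A connected set with at least two points has no isolated point, so this never happens on
  \<open>J\<close>, end points included.\<close>

lemma at_within_interval_neq_bot:
  fixes J :: "real set"
  assumes "is_interval J" and "a \<in> J" and "J \<noteq> {a}" and "t \<in> J"
  shows "at t within J \<noteq> bot"
proof -
  have "\<not> (\<exists>b. J = {b})"
    using assms by blast
  then have "t islimpt J"
    using assms by (intro connected_imp_perfect) (auto simp: is_interval_connected)
  then show ?thesis
    by (simp add: trivial_limit_within)
qed

lemma has_vector_derivative_zero_if_constant_on: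
  assumes "t \<in> J" and "\<And>s. s \<in> J \<Longrightarrow> f s = c"
  shows "(f has_vector_derivative 0) (at t within J)"
  by (rule has_vector_derivative_transform[OF assms(1) _ has_vector_derivative_const[of c]])
    (simp add: assms)

text \<open>Constancy is asked for on \<open>J\<close> only, so that this also applies to fields
  that are themselves time derivatives and are known only at times in \<open>J\<close>.\<close>

lemma dt_eq_zero:
  assumes "at t within J \<noteq> bot" and "t \<in> J" and "\<And>s. s \<in> J \<Longrightarrow> f x s = c"
  shows "dt J f x t = 0"
  unfolding dt_def
  using assms by (intro vector_derivative_within has_vector_derivative_zero_if_constant_on)

lemma dx_eq_if_time_independent:
  assumes "open I" and "x \<in> I" and "\<And>y. y \<in> I \<Longrightarrow> g y t = f y"
    and "(f has_real_derivative d) (at x)"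
  shows "((\<lambda>y. g y t) has_real_derivative d) (at x)" and "dx g x t = d"
proof -
  show *: "((\<lambda>y. g y t) has_real_derivative d) (at x)"
    by (rule has_field_derivative_transform_within_open[OF assms(4,1,2)]) (simp add: assms(3))
  show "dx g x t = d"
    unfolding dx_def by (rule DERIV_imp_deriv[OF *])
qed

text \<open>The profile \<open>f\<close> has to match \<open>g\<close> on
  \<open>I \<times> J\<close> only: this covers \<open>dx\<close> and \<open>dt J\<close> of a
  field, and fields prescribed only on \<open>I\<close>.\<close>

lemma C1_field_time_independent:
  assumes "open I" and J: "\<And>t. t \<in> J \<Longrightarrow> at t within J \<noteq> bot"
    and g: "\<And>x t. x \<in> I \<Longrightarrow> t \<in> J \<Longrightarrow> g x t = f x"
    and f: "\<And>x. x \<in> I \<Longrightarrow> (f has_real_derivative f' x) (at x)"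
    and f': "continuous_on I f'"
  shows "C1_field I J g"
  unfolding C1_field_def
proof (intro conjI ballI)
  fix x t assume xt: "x \<in> I" "t \<in> J"
  show "(\<lambda>y. g y t) differentiable at x"
    using dx_eq_if_time_independent(1)[OF assms(1) xt(1) _ f[OF xt(1)], of g t] g xt(2)
    unfolding real_differentiable_def by blast
  show "(\<lambda>s. g x s) differentiable at t within J"
    using has_vector_derivative_zero_if_constant_on[of t J "g x" "f x"] g xt
    by (auto intro: differentiableI_vector)
next
  have "continuous_on (I \<times> J) (\<lambda>p. f' (fst p))"
    by (rule continuous_on_compose2[OF f']) (auto intro: continuous_intros)
  moreover have "dx g x t = f' x" if "x \<in> I" "t \<in> J" for x t
    by (rule dx_eq_if_time_independent(2)[OF assms(1) that(1) _ f]) (simp_all add: g that)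
  ultimately show "continuous_on (I \<times> J) (\<lambda>(x, t). dx g x t)"
    by (subst continuous_on_cong[OF refl, of _ _ "\<lambda>p. f' (fst p)"]) auto
  have "dt J g x t = 0" if "x \<in> I" "t \<in> J" for x t
    using that g by (intro dt_eq_zero[OF J, where c = "f x"]) auto
  then show "continuous_on (I \<times> J) (\<lambda>(x, t). dt J g x t)"
    by (subst continuous_on_cong[OF refl, of _ _ "\<lambda>p. 0"]) auto
qed

lemma C2_field_time_independent:
  assumes "open I" and J: "\<And>t. t \<in> J \<Longrightarrow> at t within J \<noteq> bot"
    and f: "\<And>x. x \<in> I \<Longrightarrow> (f has_real_derivative f' x) (at x)"
    and f': "\<And>x. x \<in> I \<Longrightarrow> (f' has_real_derivative f'' x) (at x)"
    and f'': "continuous_on I f''"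
  shows "C2_field I J (\<lambda>x t. f x)"
  unfolding C2_field_def
proof (intro conjI)
  have "continuous_on I f'"
    using f' by (meson DERIV_isCont continuous_at_imp_continuous_on)
  from C1_field_time_independent[OF assms(1) J refl f this]
  show "C1_field I J (\<lambda>x t. f x)" .
  show "C1_field I J (dx (\<lambda>x t. f x))"
    by (rule C1_field_time_independent[OF assms(1) J _ f' f''])
      (simp_all add: dx_def DERIV_imp_deriv[OF f])
  show "C1_field I J (dt J (\<lambda>x t. f x))"
    by (rule C1_field_time_independent[OF assms(1) J, where f = "\<lambda>_. 0" and f' = "\<lambda>_. 0"])
      (auto intro: dt_eq_zero[OF J])
qed

lemma smooth_on_has_real_derivative:
  assumes "smooth_on I f" and "x \<in> I"
  shows "((deriv ^^ n) f has_real_derivative (deriv ^^ Suc n) f x) (at x)"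
  using assms by (auto simp: smooth_on_def DERIV_deriv_iff_real_differentiable)

text \<open>The function \<open>r\<close> is known only through its cube. Positivity identifies it
  near \<open>x\<close> with \<open>root 3\<close> composed with \<open>h\<close>, which is
  differentiable because \<open>h x > 0\<close>.\<close>

lemma has_real_derivative_cube_root:
  fixes r h :: "real \<Rightarrow> real"
  assumes "open I" and "x \<in> I" and h: "(h has_real_derivative h') (at x)"
    and r: "\<And>y. y \<in> I \<Longrightarrow> r y > 0" "\<And>y. y \<in> I \<Longrightarrow> r y ^ 3 = h y"
  shows "(r has_real_derivative h' / (3 * (r x)\<^sup>2)) (at x)"
proof -
  have root: "root 3 (h y) = r y" if "y \<in> I" for y
    using r[OF that] by (intro real_root_pos_unique) auto
  have "h x > 0"
    using r[OF assms(2)] by (metis zero_less_power)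
  then have "((\<lambda>y. root 3 (h y)) has_real_derivative inverse (3 * root 3 (h x) ^ 2) * h') (at x)"
    using DERIV_chain2[OF DERIV_real_root[of 3 "h x"] h] by simp
  then have "((\<lambda>y. root 3 (h y)) has_real_derivative h' / (3 * (r x)\<^sup>2)) (at x)"
    by (simp add: root[OF assms(2)] field_simps)
  then show ?thesis
    by (rule has_field_derivative_transform_within_open[OF _ assms(1,2)]) (simp add: root)
qed

lemma material_deriv_time_independent:
  assumes "\<And>t. t \<in> J \<Longrightarrow> at t within J \<noteq> bot" and "t \<in> J"
  shows "material_deriv J (\<lambda>x t. 0) (\<lambda>x t. f x) x t = 0"
    and "material_deriv J (\<lambda>x t. 0) (material_deriv J (\<lambda>x t. 0) (\<lambda>x t. f x)) x t = 0"
proof -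
  have *: "material_deriv J (\<lambda>x t. 0) (\<lambda>x t. f x) x s = 0" if "s \<in> J" for s
    by (simp add: material_deriv_def dt_eq_zero[OF assms(1)[OF that] that])
  from * show "material_deriv J (\<lambda>x t. 0) (\<lambda>x t. f x) x t = 0"
    using assms by simp
  \<comment> \<open>The inner field vanishes at all times in \<open>J\<close>, hence so does its
    time derivative within \<open>J\<close>; the transport term carries the factor
    \<open>u = 0\<close>.\<close>
  show "material_deriv J (\<lambda>x t. 0) (material_deriv J (\<lambda>x t. 0) (\<lambda>x t. f x)) x t = 0"
    using dt_eq_zero[OF assms(1)[OF assms(2)] assms(2), of _ x 0] *
    by (simp add: material_deriv_def[of J _ "material_deriv J _ _"])
qed

theorem proposition2p2:
  fixes \<kappa> \<gamma> X T\<^sub>0 P\<^sub>0 :: real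
    and I J :: "real set"
    and \<rho>\<^sub>e F P\<^sub>e P\<^sub>2\<^sub>e R\<^sub>e :: "real \<Rightarrow> real"
  assumes "\<kappa> \<ge> 0" and "\<gamma> > 1" and "0 < X" and "X < 1"
    and "open I" and "is_interval I"
    and "is_interval J" and "0 \<in> J" and "J \<noteq> {0}"
    and "smooth_on I \<rho>\<^sub>e"
    and "\<And>x. x \<in> I \<Longrightarrow> (F has_real_derivative \<rho>\<^sub>e x) (at x)"
    and "\<And>x. x \<in> I \<Longrightarrow> P\<^sub>e x = P\<^sub>0 - \<kappa> * F x"
    and "\<And>x. x \<in> I \<Longrightarrow> P\<^sub>2\<^sub>e x = P\<^sub>e x"
    and "\<And>x. x \<in> I \<Longrightarrow> R\<^sub>e x ^ 3 = 1 / \<rho>\<^sub>e x + X - 1"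
    and "\<And>x. x \<in> I \<Longrightarrow> \<rho>\<^sub>e x > 0"
    and "\<And>x. x \<in> I \<Longrightarrow> R\<^sub>e x > 0"
    and "\<And>x. x \<in> I \<Longrightarrow> P\<^sub>e x > 0"
  shows "bubbly_fluid_solution \<kappa> \<gamma> X T\<^sub>0 I J P\<^sub>2\<^sub>e R\<^sub>e
           (\<lambda>x t. \<rho>\<^sub>e x) (\<lambda>x t. 0) (\<lambda>x t. P\<^sub>e x) (\<lambda>x t. P\<^sub>2\<^sub>e x) (\<lambda>x t. R\<^sub>e x)"
proof -
  note F = assms(11) and P = assms(12) and P2 = assms(13) and R = assms(14)
    and pos = assms(15-17)
  have J: "at t within J \<noteq> bot" if "t \<in> J" for t
    using at_within_interval_neq_bot assms(7-9) that by blast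
  define \<rho>' \<rho>'' where "\<rho>' = deriv \<rho>\<^sub>e" and "\<rho>'' = deriv \<rho>'"
  note smooth = smooth_on_has_real_derivative[OF assms(10)]
  have d0: "(\<rho>\<^sub>e has_real_derivative \<rho>' x) (at x)" if "x \<in> I" for x
    using smooth[OF that, of 0] by (simp add: \<rho>'_def)
  have d1: "(\<rho>' has_real_derivative \<rho>'' x) (at x)" if "x \<in> I" for x
    using smooth[OF that, of 1] by (simp add: \<rho>'_def \<rho>''_def)
  \<comment> \<open>The third derivative of the density enters here, to make the second one
    continuous.\<close>
  have "isCont \<rho>'' x" if "x \<in> I" for x
    using smooth[OF that, of 2] by (simp add: \<rho>'_def \<rho>''_def numeral_2_eq_2 DERIV_isCont)
  then have c2: "continuous_on I \<rho>''"
    by (rule continuous_at_imp_continuous_on[OF ballI])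
  have c1: "continuous_on I \<rho>'" and c0: "continuous_on I \<rho>\<^sub>e"
    using d0 d1 by (meson DERIV_isCont continuous_at_imp_continuous_on)+
  \<comment> \<open>With \<open>h = 1 / \<rho>\<^sub>e + X - 1\<close>, the cube of
    \<open>R\<^sub>e\<close>, this is \<open>h' / (3 * R\<^sub>e^2)\<close>. The quotient rule then
    gives \<open>R''\<close> as
    \<open>h'' / (3 * R\<^sub>e^2) - 2 * h' * R' / (3 * R\<^sub>e^3)\<close>; continuity is read off
    from the closed form.\<close>
  define R' where "R' = (\<lambda>x. - \<rho>' x / (\<rho>\<^sub>e x)\<^sup>2 / (3 * (R\<^sub>e x)\<^sup>2))"
  define R'' where "R'' = (\<lambda>x. (2 * (\<rho>' x)\<^sup>2 / \<rho>\<^sub>e x ^ 3 - \<rho>'' x / (\<rho>\<^sub>e x)\<^sup>2) / (3 * (R\<^sub>e x)\<^sup>2)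
    + 2 * \<rho>' x * R' x / (3 * (\<rho>\<^sub>e x)\<^sup>2 * R\<^sub>e x ^ 3))"
  have r0: "(R\<^sub>e has_real_derivative R' x) (at x)" if "x \<in> I" for x
  proof -
    have "((\<lambda>x. 1 / \<rho>\<^sub>e x + X - 1) has_real_derivative - \<rho>' x / (\<rho>\<^sub>e x)\<^sup>2) (at x)"
      using pos(1)[OF that] d0[OF that]
      by (auto intro!: derivative_eq_intros simp: field_simps power2_eq_square)
    then show ?thesis
      unfolding R'_def by (rule has_real_derivative_cube_root[OF assms(5) that]) (auto simp: pos R)
  qed
  have r1: "(R' has_real_derivative R'' x) (at x)" if "x \<in> I" for x
    unfolding R'_def using pos(1,2)[OF that]
    by (auto intro!: derivative_eq_intros d0[OF that] d1[OF that] r0[OF that] simp: R''_def)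
      (simp add: field_simps power_eq_if)
  have "continuous_on I R\<^sub>e"
    using r0 by (meson DERIV_isCont continuous_at_imp_continuous_on)
  then have "continuous_on I R''"
    unfolding R''_def R'_def using c0 c1 c2 pos by (intro continuous_intros) fastforce+
  from C2_field_time_independent[OF assms(5) J r0 r1 this]
  have C_R: "C2_field I J (\<lambda>x t. R\<^sub>e x)" .
  \<comment> \<open>The formula for \<open>P\<^sub>e\<close> holds on \<open>I\<close> only;
    openness of \<open>I\<close> lets it determine the derivative.\<close>
  have p0: "(P\<^sub>e has_real_derivative - \<kappa> * \<rho>\<^sub>e x) (at x)" if "x \<in> I" for x
    by (rule has_field_derivative_transform_within_open[OF _ assms(5) that,
          where f = "\<lambda>x. P\<^sub>0 - \<kappa> * F x"])
      (auto intro!: derivative_eq_intros F that simp: P)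
  have cp: "continuous_on I (\<lambda>x. - \<kappa> * \<rho>\<^sub>e x)"
    by (intro continuous_intros c0)
  have C_P: "C1_field I J (\<lambda>x t. P\<^sub>e x)"
    by (rule C1_field_time_independent[OF assms(5) J refl p0 cp])
  have C_P2: "C1_field I J (\<lambda>x t. P\<^sub>2\<^sub>e x)"
    by (rule C1_field_time_independent[OF assms(5) J P2 p0 cp])
  have C_rho: "C1_field I J (\<lambda>x t. \<rho>\<^sub>e x)"
    by (rule C1_field_time_independent[OF assms(5) J refl d0 c1])
  have C_u: "C2_field I J (\<lambda>x t. 0)"
    by (rule C2_field_time_independent[OF assms(5) J, where f' = "\<lambda>_. 0" and f'' = "\<lambda>_. 0"]) auto
  have dx_P: "dx (\<lambda>x t. P\<^sub>e x) x t = - \<kappa> * \<rho>\<^sub>e x" if "x \<in> I" for x t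
    unfolding dx_def by (rule DERIV_imp_deriv[OF p0[OF that]])
  \<comment> \<open>An equation between functions, so that it also rewrites inside the nested
    \<open>dx (dx u)\<close>.\<close>
  have dx_0: "dx (\<lambda>x t. 0) = (\<lambda>x t. 0)"
    by (simp add: dx_def fun_eq_iff)
  have dt_const: "dt J (\<lambda>x t. f x) x t = 0" if "t \<in> J" for f x t
    by (rule dt_eq_zero[OF J[OF that] that refl])
  have state: "(1 - X + R\<^sub>e x ^ 3) * \<rho>\<^sub>e x - 1 = 0" if "x \<in> I" for x
    using pos(1)[OF that] by (simp add: R[OF that])
  have nz: "R\<^sub>e x \<noteq> 0" "P\<^sub>e x \<noteq> 0" if "x \<in> I" for x
    using pos[OF that] by auto
  \<comment> \<open>After \<open>u = 0\<close> is inserted, the mass flux is zero and the momentum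
    flux is \<open>P\<^sub>e\<close>, whose slope cancels \<open>\<kappa> * \<rho>\<^sub>e\<close>.
    Both ratios to the reference data are 1 by \<open>nz\<close>, so the heat exchange term vanishes
    for every \<open>T\<^sub>0\<close>.\<close>
  show ?thesis
    unfolding bubbly_fluid_solution_def
    using C_rho C_u C_P C_P2 C_R
    by (simp add: state nz P2 dx_P dx_0 dt_const material_deriv_time_independent[OF J])
qed

end
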